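(* Let $k\ge 3$ be an integer and let $\mathbf h=(h_1,\ldots,h_k)\in\mathbb Z^k\setminus\{\mathbf 0\}$. Suppose further that for some index $l$ with $2\le l\le k$ one has $h_l\ne 0$, but that $h_j=0$ when $j\ne l$ and $1\le j\le k$. Then, for every $\varepsilon>0$, one has \[ J_{k,k}(X;\mathbf h)\ll X^{k-l+1+\varepsilon}. \]
   Context: $J_{k,k}(X;\mathbf h)$ denotes the number of integral solutions $(x_1,\ldots,x_k,y_1,\ldots,y_k)$ of the system $\sum_{i=1}^k(x_i^j-y_i^j)=h_j$ $(1\le j\le k)$ with $1\le x_i,y_i\le X$ for all $i$. Here $X$ is a sufficiently large positive real number, and the constant implicit in $\ll$ may depend on $\varepsilon$ and $k$ (only). *)

theory Defs
  imports Complex_Main "HOL-Library.FuncSet"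
begin

text \<open>
  \<open>Jsol s k X h\<close> is the set of integral solutions \<open>(x, y)\<close>, with \<open>1 \<le> x i, y i \<le> X\<close>, of the
  Vinogradov system of degree \<open>k\<close> in \<open>s\<close> pairs of variables. An integer vector of length \<open>n\<close> is
  represented by its values at \<open>1, \<dots>, n\<close>; the extensional function space makes the representation
  of \<open>x\<close> and \<open>y\<close> unique, so that the solution set is finite and its cardinality is the number of
  solutions. Only the values \<open>h 1, \<dots>, h k\<close> are used.
\<close>

definition Jsol :: "nat \<Rightarrow> nat \<Rightarrow> real \<Rightarrow> (nat \<Rightarrow> int) \<Rightarrow> ((nat \<Rightarrow> int) \<times> (nat \<Rightarrow> int)) set" where
  "Jsol s k X h =
     {(x, y). x \<in> {1..s} \<rightarrow>\<^sub>E {n. 1 \<le> n \<and> real_of_int n \<le> X} \<and>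
              y \<in> {1..s} \<rightarrow>\<^sub>E {n. 1 \<le> n \<and> real_of_int n \<le> X} \<and>
              (\<forall>j\<in>{1..k}. (\<Sum>i=1..s. x i ^ j - y i ^ j) = h j)}"

definition J :: "nat \<Rightarrow> nat \<Rightarrow> real \<Rightarrow> (nat \<Rightarrow> int) \<Rightarrow> nat" where
  "J s k X h = card (Jsol s k X h)"

end

theory Submission
  imports Defs "HOL-Computational_Algebra.Formal_Power_Series"
    "HOL-Computational_Algebra.Primes" "HOL-Library.Multiset"
begin

text \<open>
  Let \<open>A\<close> and \<open>B\<close> be the multisets of the values of \<open>x\<close> and of \<open>y\<close>. Their power sums of degree up to \<open>k\<close>
  agree, except that those of degree \<open>l\<close> differ by \<open>h = h l\<close>. By Newton's identities this says
  \<open>\<Prod>a\<in>A. (1 - a z) \<equiv> exp (- h z^l / l) * \<Prod>b\<in>B. (1 - b z)\<close> modulo \<open>z^(k+1)\<close>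
  (\<open>recip_poly_twist\<close>). Fix one \<open>b\<close> in \<open>B\<close>, let \<open>B'\<close> be the rest of \<open>B\<close>, and divide by \<open>1 - b z\<close>.
  Comparing coefficients of \<open>z^k\<close> expresses \<open>\<Prod>a\<in>A. (b - a)\<close> as the coefficient of \<open>z^k\<close> in
  \<open>(exp (- h z^l / l) - 1) * \<Prod>c\<in>B'. (1 - c z)\<close>
  (\<open>prod_diff_eq_coeff\<close>). Up to a bounded denominator this is \<open>h\<close> times an integer \<open>M\<close>, and \<open>M\<close> has
  order at most \<open>X^(k-l)\<close>, because \<open>h\<close> has order at most \<open>X^l\<close> (\<open>prod_diff_cofactor\<close>).

  There are thus \<open>X\<close> choices for \<open>b\<close> and about \<open>X^(k-l)\<close> choices for \<open>M\<close>. Together they fix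
  \<open>\<Prod>a\<in>A. (b - a)\<close>. When this product is not zero, all the \<open>b - a\<close> divide a fixed non-zero integer
  of size at most \<open>X^k\<close>, so by the divisor bound there are at most about \<open>X powr \<epsilon>\<close> choices
  for \<open>A\<close>; and \<open>A\<close> determines \<open>B\<close>, because its power sums do. When the product is zero, \<open>b\<close> occurs in
  both \<open>A\<close> and \<open>B\<close>. Cancelling it costs a factor \<open>X\<close> and leaves the same system with one pair of
  variables fewer, whose number of solutions is smaller by a factor \<open>X\<close> by induction. The
  induction (\<open>card_mset_sols_le\<close>) ends once fewer than \<open>l\<close> pairs are left: then all the power sums that
  determine a multiset agree, so \<open>A = B\<close>, contradicting \<open>h \<noteq> 0\<close>.
\<close>

unbundle fps_syntax

section \<open>Bounding the number of divisors\<close>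

lemma card_divisors_prime_power_mult_le:
  fixes p m :: nat
  assumes "prime p" "m > 0"
  shows "card {d. d dvd p ^ a * m} \<le> Suc a * card {d. d dvd m}"
proof -
  have fin: "finite {d. d dvd m}" using assms by simp
  have "{d. d dvd p ^ a * m} \<subseteq> (\<lambda>(i, d). p ^ i * d) ` ({..a} \<times> {d. d dvd m})"
  proof
    fix d assume "d \<in> {d. d dvd p ^ a * m}"
    then obtain b c where "d = b * c" "b dvd p ^ a" "c dvd m"
      using division_decomp by blast
    moreover then obtain i where "i \<le> a" "b = p ^ i"
      using assms divides_primepow_nat by blast
    ultimately show "d \<in> (\<lambda>(i, d). p ^ i * d) ` ({..a} \<times> {d. d dvd m})" by auto
  qed
  then have "card {d. d dvd p ^ a * m} \<le> card ((\<lambda>(i, d). p ^ i * d) ` ({..a} \<times> {d. d dvd m}))"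
    using fin by (intro card_mono) auto
  also have "\<dots> \<le> card ({..a} \<times> {d. d dvd m})"
    using fin by (intro card_image_le) auto
  finally show ?thesis by (simp only: card_cartesian_product card_atMost)
qed

text \<open>
  Split off the full power \<open>p ^ a\<close> of a prime divisor: this costs a factor \<open>a + 1\<close> in the number of
  divisors and gains \<open>(p powr \<epsilon>) ^ a\<close> on the right. If \<open>p powr \<epsilon> \<ge> 2\<close>, the gain alone suffices, because
  \<open>a + 1 \<le> 2 ^ a\<close>. Otherwise \<open>a + 1 \<le> c * (2 powr \<epsilon>) ^ a\<close> for a constant \<open>c\<close>, and such a loss of \<open>c\<close>
  occurs for at most finitely many primes.
\<close>
lemma divisor_bound:
  fixes \<epsilon> :: real
  assumes "\<epsilon> > 0"
  obtains C where "C \<ge> 1" "\<And>n::nat. n > 0 \<Longrightarrow> real (card {d. d dvd n}) \<le> C * real n powr \<epsilon>"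
proof -
  define c where "c = max 1 (1 / (\<epsilon> * ln 2))"
  have c1: "c \<ge> 1" by (simp add: c_def)
  have c: "real (Suc a) \<le> c * (2 powr \<epsilon>) ^ a" for a
  proof -
    have "1 \<le> c * (\<epsilon> * ln 2)"
      using assms by (simp add: c_def max_def field_simps)
    then have "real a \<le> c * (\<epsilon> * ln 2) * real a" 
      by (metis mult_left_mono mult.commute mult.right_neutral of_nat_0_le_iff)
    then have "real (Suc a) \<le> c * (1 + real a * (\<epsilon> * ln 2))"
      using c1 by (simp add: algebra_simps)
    also have "\<dots> \<le> c * exp (real a * (\<epsilon> * ln 2))"
      using c1 by (intro mult_left_mono exp_ge_add_one_self) auto
    also have "exp (real a * (\<epsilon> * ln 2)) = (2 powr \<epsilon>) ^ a"
      by (simp add: powr_def exp_of_nat_mult)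
    finally show ?thesis .
  qed
  \<comment> \<open>The finitely many small primes, each of which may cost a factor \<open>c\<close>.\<close>
  define P where "P = {p::nat. prime p \<and> real p powr \<epsilon> < 2}"
  have finP: "finite P"
  proof (rule finite_subset)
    show "P \<subseteq> {..nat \<lceil>2 powr (1 / \<epsilon>)\<rceil>}"
    proof
      fix p assume "p \<in> P"
      then have "real p > 0" "real p powr \<epsilon> < 2" by (auto simp: P_def prime_gt_0_nat)
      then have "(real p powr \<epsilon>) powr (1 / \<epsilon>) < 2 powr (1 / \<epsilon>)"
        using assms by (intro powr_less_mono2) auto
      then have "real p < 2 powr (1 / \<epsilon>)" using assms \<open>real p > 0\<close> by (simp add: powr_powr)
      then show "p \<in> {..nat \<lceil>2 powr (1 / \<epsilon>)\<rceil>}" by (simp add: le_nat_iff) linarith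
    qed
  qed simp
  have main: "real (card {d. d dvd n}) \<le> c ^ card {p\<in>P. p dvd n} * real n powr \<epsilon>" if "n > 0" for n
    using that
  proof (induction n rule: less_induct)
    case (less n)
    show ?case
    proof (cases "n = 1")
      case True
      then show ?thesis using one_le_power[OF c1] by simp
    next
      case False
      then obtain p where p: "prime p" "p dvd n" using prime_factor_nat by blast
      obtain m where m: "n = p ^ multiplicity p n * m" "\<not> p dvd m"
        using multiplicity_decompose'[of n p] p less.prems by (metis not_prime_unit less_irrefl)
      define a where "a = multiplicity p n"
      have n: "n = p ^ a * m" using m by (simp add: a_def)
      have m0: "m > 0" using less.prems n by (cases m) auto
      have a0: "a \<noteq> 0" using p m n by (metis mult_1 power_0)
      have "p ^ a > 1" using p a0 by (metis one_less_power prime_gt_1_nat neq0_conv)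
      then have mn: "m < n" using n m0 by simp
      let ?d = "\<lambda>n. card {p\<in>P. p dvd n}"
      have p2: "real p \<ge> 2" using p prime_ge_2_nat by (metis of_nat_le_iff of_nat_numeral)
      have npow: "real n powr \<epsilon> = (real p powr \<epsilon>) ^ a * real m powr \<epsilon>"
        using p2 by (simp add: n powr_mult powr_powr mult.commute flip: powr_realpow)
      have sub: "{q\<in>P. q dvd m} \<subseteq> {q\<in>P. q dvd n}" using n by auto
      \<comment> \<open>A small \<open>p\<close> divides \<open>n\<close> but not \<open>m\<close>, so the exponent of \<open>c\<close> has room for one more factor.\<close>
      have step: "real (Suc a) * c ^ ?d m \<le> c ^ ?d n * (real p powr \<epsilon>) ^ a"
      proof (cases "p \<in> P")
        case True
        have "{q\<in>P. q dvd m} \<subset> {q\<in>P. q dvd n}" using sub True p m by auto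
        then have "Suc (?d m) \<le> ?d n" using finP by (intro Suc_leI psubset_card_mono) auto
        then have "c * c ^ ?d m \<le> c ^ ?d n" using c1 by (metis power_Suc power_increasing)
        moreover have "(2 powr \<epsilon>) ^ a \<le> (real p powr \<epsilon>) ^ a"
          using p2 assms by (intro power_mono powr_mono2) auto
        ultimately have "(c * c ^ ?d m) * (2 powr \<epsilon>) ^ a \<le> c ^ ?d n * (real p powr \<epsilon>) ^ a"
          using c1 by (intro mult_mono) auto
        moreover have "real (Suc a) * c ^ ?d m \<le> (c * (2 powr \<epsilon>) ^ a) * c ^ ?d m"
          using c1 c[of a] by (intro mult_right_mono) auto
        ultimately show ?thesis by (simp add: mult_ac)
      next
        case False
        then have "2 \<le> real p powr \<epsilon>" using p by (auto simp: P_def)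
        then have "2 ^ a \<le> (real p powr \<epsilon>) ^ a" by (intro power_mono) auto
        moreover have "real (Suc a) \<le> 2 ^ a"
          by (metis Suc_leI less_exp of_nat_le_iff of_nat_numeral of_nat_power)
        moreover have "c ^ ?d m \<le> c ^ ?d n" using c1 finP sub by (intro power_increasing card_mono) auto
        ultimately have "real (Suc a) * c ^ ?d m \<le> (real p powr \<epsilon>) ^ a * c ^ ?d n"
          using c1 by (intro mult_mono) auto
        then show ?thesis by (simp add: mult_ac)
      qed
      have "real (card {d. d dvd n}) \<le> real (Suc a * card {d. d dvd m})"
        unfolding n using card_divisors_prime_power_mult_le[OF p(1) m0] by (simp only: of_nat_le_iff)
      also have "\<dots> = real (Suc a) * real (card {d. d dvd m})" by (rule of_nat_mult)
      also have "\<dots> \<le> real (Suc a) * (c ^ ?d m * real m powr \<epsilon>)"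
        using less.IH[OF mn m0] by (intro mult_left_mono) auto
      also have "\<dots> \<le> (c ^ ?d n * (real p powr \<epsilon>) ^ a) * real m powr \<epsilon>"
        using mult_right_mono[OF step, of "real m powr \<epsilon>"] by (simp add: mult.assoc)
      also have "\<dots> = c ^ ?d n * real n powr \<epsilon>" by (simp add: npow mult.assoc)
      finally show ?thesis .
    qed
  qed
  show ?thesis
  proof (rule that)
    show "c ^ card P \<ge> 1" using c1 by (rule one_le_power)
    fix n :: nat assume n: "n > 0"
    have "c ^ card {p\<in>P. p dvd n} \<le> c ^ card P"
      using c1 finP by (intro power_increasing card_mono) auto
    then show "real (card {d. d dvd n}) \<le> c ^ card P * real n powr \<epsilon>"
      using main[OF n] mult_right_mono[of _ _ "real n powr \<epsilon>"] by (meson order_trans powr_ge_zero)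
  qed
qed

section \<open>Power sums and reciprocal polynomials\<close>

definition psum :: "nat \<Rightarrow> int multiset \<Rightarrow> int" where
  "psum j A = (\<Sum>a\<in>#A. a ^ j)"

lemma psum_add_mset [simp]: "psum j (add_mset a A) = a ^ j + psum j A"
  by (simp add: psum_def)

text \<open>
  Up to reversal of coefficients this is the monic polynomial with root multiset \<open>A\<close>. In the
  reciprocal form, the first \<open>n\<close> coefficients are governed by the first \<open>n\<close> power sums, whatever the
  size of \<open>A\<close>.
\<close>
definition recip_poly :: "int multiset \<Rightarrow> real fps" where
  "recip_poly A = (\<Prod>a\<in>#A. 1 - fps_const (of_int a) * fps_X)"

lemma recip_poly_empty [simp]: "recip_poly {#} = 1"
  by (simp add: recip_poly_def)

lemma recip_poly_add_mset:
  "recip_poly (add_mset a A) = (1 - fps_const (of_int a) * fps_X) * recip_poly A"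
  by (simp add: recip_poly_def)

lemma recip_poly_add_mset_nth:
  "recip_poly (add_mset a A) $ n
     = recip_poly A $ n - (if n = 0 then 0 else of_int a * recip_poly A $ (n - 1))"
  by (simp add: recip_poly_add_mset left_diff_distrib mult.assoc)

lemma recip_poly_nth_0 [simp]: "recip_poly A $ 0 = 1"
  by (induction A) (simp_all add: recip_poly_add_mset_nth)

lemma recip_poly_nth_Ints: "recip_poly A $ n \<in> \<int>"
  by (induction A arbitrary: n) (auto simp: recip_poly_add_mset_nth)

lemma recip_poly_nth_eq_0: "size A < n \<Longrightarrow> recip_poly A $ n = 0"
  by (induction A arbitrary: n) (auto simp: recip_poly_add_mset_nth)

lemma abs_recip_poly_nth_le:
  assumes "X \<ge> 0" "\<forall>a\<in>#A. \<bar>of_int a\<bar> \<le> X"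
  shows "\<bar>recip_poly A $ n\<bar> \<le> 2 ^ size A * X ^ n"
  using assms(2)
proof (induction A arbitrary: n)
  case empty
  show ?case using assms(1) by (cases n) auto
next
  case (add a A)
  then have IH: "\<bar>recip_poly A $ m\<bar> \<le> 2 ^ size A * X ^ m" for m by simp
  have a: "\<bar>of_int a\<bar> \<le> X" using add.prems by simp
  show ?case
  proof (cases n)
    case 0
    then show ?thesis using one_le_power[of "2::real" "size A"] by (simp del: one_le_power)
  next
    case (Suc m)
    have "\<bar>of_int a * recip_poly A $ m\<bar> \<le> X * (2 ^ size A * X ^ m)"
      unfolding abs_mult using assms(1) a IH[of m] by (intro mult_mono) auto
    then show ?thesis
      using IH[of n] Suc abs_triangle_ineq4[of "recip_poly A $ n" "of_int a * recip_poly A $ m"]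
      by (simp add: recip_poly_add_mset_nth mult_ac)
  qed
qed

definition geom :: "int \<Rightarrow> real fps" where
  "geom b = Abs_fps (\<lambda>n. of_int b ^ n)"

lemma geom_inverse: "(1 - fps_const (of_int b) * fps_X) * geom b = 1"
proof (rule fps_ext)
  fix n show "((1 - fps_const (of_int b) * fps_X) * geom b) $ n = 1 $ n"
    by (cases n) (simp_all add: left_diff_distrib mult.assoc geom_def)
qed

text \<open>
  Dividing by \<open>1 - b z\<close> evaluates the monic polynomial at \<open>b\<close>: the coefficient of \<open>z ^ n\<close> in
  \<open>f(z) / (1 - b z)\<close> is \<open>\<Sum>i\<le>n. f $ i * b ^ (n - i)\<close>, and \<open>recip_poly\<close> reverses coefficients.
\<close>
lemma recip_poly_geom_nth:
  assumes "size A \<le> n"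
  shows "(recip_poly A * geom b) $ n = of_int (b ^ (n - size A) * (\<Prod>a\<in>#A. b - a))"
  using assms
proof (induction A arbitrary: n)
  case empty
  then show ?case by (simp add: geom_def)
next
  case (add a A)
  then obtain m where m: "n = Suc m" "size A \<le> m" by (cases n) auto
  have "(recip_poly (add_mset a A) * geom b) $ n
      = (recip_poly A * geom b) $ n - of_int a * (recip_poly A * geom b) $ m"
    using m by (simp add: recip_poly_add_mset left_diff_distrib mult.assoc)
  also have "\<dots> = of_int (b ^ (n - size A) * (\<Prod>x\<in>#A. b - x))
                   - of_int a * of_int (b ^ (m - size A) * (\<Prod>x\<in>#A. b - x))"
    using add.IH[of n] add.IH[of m] m by simp
  also have "\<dots> = of_int (b ^ (m - size A) * ((b - a) * (\<Prod>x\<in>#A. b - x)))"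
    using m by (simp add: Suc_diff_le algebra_simps)
  finally show ?case using m by simp
qed

definition psum_series :: "int multiset \<Rightarrow> real fps" where
  "psum_series A = Abs_fps (\<lambda>n. of_int (psum (Suc n) A))"

text \<open>
  Newton's identities in the form of the logarithmic derivative of \<open>\<Prod>a. 1 - a z\<close>.
\<close>
lemma deriv_recip_poly: "fps_deriv (recip_poly A) = - psum_series A * recip_poly A"
proof (induction A)
  case empty
  have "psum_series {#} = 0" by (rule fps_ext) (simp add: psum_series_def psum_def)
  then show ?case by simp
next
  case (add a A)
  define u :: "real fps" where "u = 1 - fps_const (of_int a) * fps_X"
  have P: "psum_series (add_mset a A) = fps_const (of_int a) * geom a + psum_series A"
    by (rule fps_ext) (simp add: psum_series_def geom_def)
  have u': "fps_deriv u = - fps_const (of_int a)" by (simp add: u_def)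
  have g: "u * geom a = 1" unfolding u_def by (rule geom_inverse)
  have "fps_deriv (recip_poly (add_mset a A))
      = u * (- psum_series A * recip_poly A) - fps_const (of_int a) * recip_poly A"
    by (simp add: recip_poly_add_mset u_def[symmetric] u' add.IH del: fps_const_neg)
  also have "\<dots> = u * (- psum_series A * recip_poly A) - fps_const (of_int a) * (u * geom a) * recip_poly A"
    by (simp add: g)
  also have "\<dots> = - psum_series (add_mset a A) * (u * recip_poly A)"
    unfolding P by (simp add: algebra_simps)
  finally show ?case by (simp add: recip_poly_add_mset u_def)
qed

section \<open>Power sums that differ in a single degree\<close>

text \<open>
  The power series \<open>exp (- h z ^ l / l)\<close>.
\<close>
definition twist :: "int \<Rightarrow> nat \<Rightarrow> real fps" where
  "twist h l = Abs_fps (\<lambda>n. if l dvd n then (- of_int h / real l) ^ (n div l) / fact (n div l) else 0)"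

lemma twist_nth_0 [simp]: "twist h l $ 0 = 1"
  by (simp add: twist_def)

lemma twist_0: "l \<ge> 1 \<Longrightarrow> twist 0 l = 1"
  by (rule fps_ext) (auto simp: twist_def power_0_left elim!: dvdE)

lemma deriv_twist:
  assumes "l \<ge> 1"
  shows "fps_deriv (twist h l) = - (fps_const (of_int h) * fps_X ^ (l - 1)) * twist h l"
proof (rule fps_ext)
  fix n
  have rhs: "(- (fps_const (of_int h) * fps_X ^ (l - 1)) * twist h l) $ n
      = (if n < l - 1 then 0 else - of_int h * twist h l $ (n - (l - 1)))"
    by (simp add: mult.assoc fps_X_power_mult_nth)
  show "fps_deriv (twist h l) $ n = (- (fps_const (of_int h) * fps_X ^ (l - 1)) * twist h l) $ n"
  proof (cases "l dvd Suc n")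
    case True
    then obtain q where q: "Suc n = l * q" by (elim dvdE)
    then obtain r where r: "q = Suc r" by (cases q) auto
    define w where "w = - of_int h / real l"
    have n: "n - (l - 1) = l * r" "\<not> n < l - 1" using q r assms by (auto simp: algebra_simps)
    have "fps_deriv (twist h l) $ n = real (l * q) * twist h l $ (l * q)"
      using q by (simp add: fps_deriv_nth)
    also have "\<dots> = real (l * q) * (w ^ q / fact q)"
      using assms by (simp add: twist_def w_def)
    also have "\<dots> = (real l * w) * (w ^ r / fact r)"
      using assms r by (simp add: divide_simps del: of_nat_Suc) (simp add: algebra_simps)
    also have "\<dots> = - of_int h * ((- of_int h / real l) ^ r / fact r)"
      using assms by (simp add: w_def)
    also have "\<dots> = - of_int h * twist h l $ (l * r)"
      using assms by (simp add: twist_def)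
    finally show ?thesis using n rhs by simp
  next
    case False
    have "\<not> l dvd n - (l - 1)" if "\<not> n < l - 1"
    proof
      assume "l dvd n - (l - 1)"
      then have "l dvd n - (l - 1) + l" by simp
      also have "n - (l - 1) + l = Suc n" using that assms by simp
      finally show False using False by simp
    qed
    then show ?thesis using False rhs by (simp add: fps_deriv_nth twist_def)
  qed
qed

text \<open>
  In formal terms the logarithm of \<open>recip_poly A / recip_poly B\<close> is
  \<open>- (\<Sum>j. (psum j A - psum j B) z ^ j / j)\<close>, which is \<open>- h z ^ l / l\<close> up to degree \<open>K\<close>. The proof
  avoids logarithms: both sides satisfy the same first order linear differential equation up to
  degree \<open>K - 1\<close>, and have the same constant term.
\<close>
lemma recip_poly_twist:
  assumes l: "l \<ge> 1"
    and ps: "\<forall>j\<in>{1..K}. psum j A - psum j B = (if j = l then h else 0)"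
    and "n \<le> K"
  shows "recip_poly A $ n = (recip_poly B * twist h l) $ n"
proof -
  define G where "G = recip_poly A - recip_poly B * twist h l"
  define W where "W = psum_series B - psum_series A + fps_const (of_int h) * fps_X ^ (l - 1)"
  \<comment> \<open>The inhomogeneous term is divisible by \<open>z ^ K\<close>, since \<open>W\<close> is.\<close>
  have G': "fps_deriv G = W * (recip_poly B * twist h l) - psum_series A * G"
    unfolding G_def W_def using l by (simp add: deriv_recip_poly deriv_twist algebra_simps)
  have W: "W $ i = 0" if "i < K" for i
  proof -
    have "psum (Suc i) A - psum (Suc i) B = (if Suc i = l then h else 0)"
      using ps that by auto
    then have "real_of_int (psum (Suc i) A) - of_int (psum (Suc i) B) = (if Suc i = l then of_int h else 0)"
      by (metis of_int_0 of_int_diff)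
    then show ?thesis using l by (auto simp: W_def psum_series_def split: if_splits)
  qed
  have "G $ n = 0" using \<open>n \<le> K\<close>
  proof (induction n rule: less_induct)
    case (less n)
    show ?case
    proof (cases n)
      case 0
      then show ?thesis by (simp add: G_def)
    next
      case (Suc m)
      have 1: "(W * (recip_poly B * twist h l)) $ m = 0"
        unfolding fps_mult_nth using W Suc less.prems by (intro sum.neutral) auto
      have 2: "(psum_series A * G) $ m = 0"
        unfolding fps_mult_nth[of "psum_series A"] using less Suc by (intro sum.neutral) auto
      have "real n * G $ n = fps_deriv G $ m" using Suc by (simp add: fps_deriv_nth)
      also have "\<dots> = 0" unfolding G' using 1 2 by simp
      finally show ?thesis using Suc by simp
    qed
  qed
  then show ?thesis by (simp add: G_def)
qed

text \<open>
  The product is the monic polynomial with roots \<open>A\<close>, evaluated at \<open>b\<close>. By the preceding lemma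
  \<open>recip_poly A\<close> may be replaced by \<open>(1 - b z) * recip_poly B * twist h l\<close>, and the linear factor cancels
  against the division by \<open>1 - b z\<close> that evaluates at \<open>b\<close>. Subtracting \<open>1\<close> from the twist changes
  nothing, for \<open>recip_poly B\<close> has degree less than \<open>size A\<close>; it is this subtraction that makes
  every remaining term divisible by \<open>h\<close>.
\<close>
lemma prod_diff_eq_coeff:
  assumes l: "l \<ge> 1"
    and ps: "\<forall>j\<in>{1..K}. psum j A - psum j (add_mset b B) = (if j = l then h else 0)"
    and size: "size A = Suc (size B)" "size A \<le> K"
  shows "of_int (\<Prod>a\<in>#A. b - a) = (recip_poly B * (twist h l - 1)) $ size A"
proof -
  have "of_int (\<Prod>a\<in>#A. b - a) = (recip_poly A * geom b) $ size A"
    by (simp add: recip_poly_geom_nth)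
  also have "\<dots> = (recip_poly (add_mset b B) * twist h l * geom b) $ size A"
    unfolding fps_mult_nth[of _ "geom b"]
    using size by (intro sum.cong refl arg_cong2[of _ _ _ _ "(*)"] recip_poly_twist[OF l ps]) auto
  also have "recip_poly (add_mset b B) * twist h l * geom b
      = ((1 - fps_const (of_int b) * fps_X) * geom b) * (recip_poly B * twist h l)"
    by (simp add: recip_poly_add_mset mult_ac)
  also have "\<dots> = recip_poly B * (twist h l - 1) + recip_poly B"
    unfolding geom_inverse by (simp add: algebra_simps)
  finally show ?thesis using size by (simp add: recip_poly_nth_eq_0)
qed

text \<open>
  The case \<open>h = 0\<close> of the product formula: \<open>\<Prod>a\<in>#A. b - a\<close> vanishes for every \<open>b\<close> in \<open>B\<close>, so that \<open>b\<close>
  occurs in \<open>A\<close> and may be cancelled.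
\<close>
lemma mset_eq_if_psum_eq:
  assumes "size A = size B" "\<forall>j\<in>{1..size A}. psum j A = psum j B"
  shows "A = B"
  using assms
proof (induction B arbitrary: A)
  case empty
  then show ?case by simp
next
  case (add b B)
  have "real_of_int (\<Prod>a\<in>#A. b - a) = (recip_poly B * (twist 0 1 - 1)) $ size A"
    using add.prems by (intro prod_diff_eq_coeff[where K = "size A"]) auto
  then have "(\<Prod>a\<in>#A. b - a) = 0" by (simp add: twist_0)
  then have "b \<in># A" by (auto simp: prod_mset_zero_iff)
  then obtain A' where A': "A = add_mset b A'" by (metis insert_DiffM)
  have "A' = B" using add.prems A' by (intro add.IH) auto
  then show ?case using A' by simp
qed

text \<open>
  The coefficient of \<open>z ^ (l * m)\<close> in \<open>twist h l\<close> is \<open>(- h / l) ^ m / m!\<close>. After denominators are cleared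
  it is \<open>h\<close> times an integer of order \<open>\<bar>h\<bar> ^ (m - 1)\<close>, which is at most of order \<open>X ^ (l * m - l)\<close> as
  \<open>h\<close> itself is at most of order \<open>X ^ l\<close>.
\<close>
lemma twist_nth_bound:
  assumes l: "l \<ge> 1" "l \<le> K" and n: "1 \<le> n" "n \<le> K"
    and X: "X \<ge> 1" and h: "\<bar>of_int h\<bar> \<le> real K * X ^ l"
  shows "\<exists>N\<in>\<int>. real (l ^ K * fact K) * twist h l $ n = of_int h * N \<and>
           \<bar>N\<bar> \<le> real (K ^ K * K ^ K * fact K) * X ^ (n - l) \<and> (n < l \<longrightarrow> N = 0)"
proof (cases "l dvd n")
  case False
  then show ?thesis using X by (intro bexI[of _ 0]) (auto simp: twist_def)
next
  case True
  then obtain m where m: "n = l * Suc m" using n by (metis dvdE mult_0_right not_one_le_zero old.nat.exhaust)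
  have mK: "Suc m \<le> K" using m n l by (metis le_trans mult_le_mono1 nat_mult_1)
  define N :: real where "N = - ((- of_int h) ^ m * real (l ^ (K - Suc m)) * real (fact K div fact (Suc m)))"
  have fd: "real (fact K div fact (Suc m)) = fact K / fact (Suc m)"
    using mK by (simp add: real_of_nat_div fact_dvd del: fact_Suc)
  have lp: "real l ^ K = real l ^ (K - Suc m) * real l ^ Suc m"
    using mK by (metis le_add_diff_inverse2 power_add)
  have tn: "twist h l $ n = (- of_int h / real l) ^ Suc m / fact (Suc m)"
    using l m by (simp add: twist_def)
  have l0: "real l > 0" using l by simp
  have "real (l ^ K * fact K) * twist h l $ n = of_int h * N"
    unfolding tn N_def fd of_nat_mult of_nat_power lp of_nat_fact power_divide using l0
    by (simp add: field_simps del: fact_Suc)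
  moreover have "\<bar>N\<bar> \<le> real (K ^ K * K ^ K * fact K) * X ^ (n - l)"
  proof -
    have "\<bar>real_of_int h\<bar> ^ m \<le> (real K * X ^ l) ^ m" using h by (intro power_mono) auto
    also have "\<dots> = real K ^ m * X ^ (n - l)" using m by (simp add: power_mult_distrib power_mult)
    also have "\<dots> \<le> real K ^ K * X ^ (n - l)"
      using mK X by (intro mult_right_mono power_increasing) auto
    finally have 1: "\<bar>real_of_int h\<bar> ^ m \<le> real K ^ K * X ^ (n - l)" .
    have "l ^ (K - Suc m) \<le> K ^ (K - Suc m)" using l by (intro power_mono) auto
    also have "\<dots> \<le> K ^ K" using l by (intro power_increasing) auto
    finally have 2: "real (l ^ (K - Suc m)) \<le> real (K ^ K)" by (simp only: of_nat_le_iff)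
    have 3: "real (fact K div fact (Suc m)) \<le> real (fact K)" by (simp only: of_nat_le_iff div_le_dividend)
    have "\<bar>N\<bar> = \<bar>real_of_int h\<bar> ^ m * real (l ^ (K - Suc m)) * real (fact K div fact (Suc m))"
      by (simp add: N_def abs_mult power_abs del: fact_Suc)
    also have "\<dots> \<le> (real K ^ K * X ^ (n - l)) * real (K ^ K) * real (fact K)"
      using 1 2 3 X by (intro mult_mono mult_nonneg_nonneg) auto
    finally show ?thesis by (simp add: mult_ac)
  qed
  moreover have "N \<in> \<int>" by (simp add: N_def del: fact_Suc)
  moreover have "\<not> n < l" using m by simp
  ultimately show ?thesis by blast
qed

definition cofactor_const :: "nat \<Rightarrow> real" where
  "cofactor_const K = real K * (real (K ^ K * K ^ K * fact K) * 2 ^ K)"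

text \<open>
  The saving of the theorem is made here. When \<open>b\<close> and \<open>h\<close> are given, the product depends on \<open>B\<close>
  only through the integer \<open>M\<close>, a weighted sum of elementary symmetric functions of \<open>B\<close>. All its
  terms have the same order of magnitude \<open>X ^ (size A - l)\<close>: the twist contributes \<open>X ^ (n - l)\<close> and
  the elementary symmetric function of degree \<open>size A - n\<close> contributes \<open>X ^ (size A - n)\<close>.
\<close>
lemma prod_diff_cofactor:
  assumes l: "l \<ge> 1" "l \<le> K"
    and ps: "\<forall>j\<in>{1..K}. psum j A - psum j (add_mset b B) = (if j = l then h else 0)"
    and size: "size A = Suc (size B)" "size A \<le> K" "l \<le> size A"
    and X: "X \<ge> 1" and h: "\<bar>of_int h\<bar> \<le> real K * X ^ l"
    and B: "\<forall>a\<in>#B. \<bar>of_int a\<bar> \<le> X"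
  shows "\<exists>M::int. int (l ^ K * fact K) * (\<Prod>a\<in>#A. b - a) = h * M \<and>
           \<bar>of_int M\<bar> \<le> cofactor_const K * X ^ (size A - l)"
proof -
  define s where "s = size A"
  define c where "c = real (K ^ K * K ^ K * fact K)"
  have "\<forall>n. \<exists>N. n \<in> {1..s} \<longrightarrow> N \<in> \<int> \<and> real (l ^ K * fact K) * twist h l $ n = of_int h * N \<and>
           \<bar>N\<bar> \<le> c * X ^ (n - l) \<and> (n < l \<longrightarrow> N = 0)"
    using twist_nth_bound[OF l _ _ X h] size unfolding s_def c_def by (meson atLeastAtMost_iff le_trans)
  then obtain N where N: "\<And>n. n \<in> {1..s} \<Longrightarrow> N n \<in> \<int> \<and>
       real (l ^ K * fact K) * twist h l $ n = of_int h * N n \<and>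
       \<bar>N n\<bar> \<le> c * X ^ (n - l) \<and> (n < l \<longrightarrow> N n = 0)" by metis
  define M where "M = (\<Sum>n\<in>{1..s}. N n * recip_poly B $ (s - n))"
  have "M \<in> \<int>" unfolding M_def using N by (intro Ints_sum Ints_mult recip_poly_nth_Ints) auto
  then obtain M' where M': "M = of_int M'" by (elim Ints_cases)
  have "real_of_int (\<Prod>a\<in>#A. b - a) = ((twist h l - 1) * recip_poly B) $ s"
    unfolding s_def prod_diff_eq_coeff[OF l(1) ps size(1,2)] by (simp add: mult.commute)
  also have "\<dots> = (\<Sum>n\<in>{1..s}. (twist h l - 1) $ n * recip_poly B $ (s - n))"
    unfolding fps_mult_nth by (rule sum.mono_neutral_right) (auto simp: not_less_eq_eq)
  also have "\<dots> = (\<Sum>n\<in>{1..s}. twist h l $ n * recip_poly B $ (s - n))"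
    by (intro sum.cong) auto
  finally have "real (l ^ K * fact K) * of_int (\<Prod>a\<in>#A. b - a)
     = (\<Sum>n\<in>{1..s}. (real (l ^ K * fact K) * twist h l $ n) * recip_poly B $ (s - n))"
    by (simp add: sum_distrib_left mult.assoc)
  also have "\<dots> = (\<Sum>n\<in>{1..s}. (of_int h * N n) * recip_poly B $ (s - n))"
    using N by (intro sum.cong) auto
  also have "\<dots> = of_int h * M" by (simp add: M_def sum_distrib_left mult.assoc)
  finally have "real_of_int (int (l ^ K * fact K) * (\<Prod>a\<in>#A. b - a)) = real_of_int (h * M')"
    by (simp add: M')
  then have eq: "int (l ^ K * fact K) * (\<Prod>a\<in>#A. b - a) = h * M'" by (simp only: of_int_eq_iff)
  have c0: "c \<ge> 0" by (simp add: c_def)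
  have "\<bar>M\<bar> \<le> (\<Sum>n\<in>{1..s}. \<bar>N n * recip_poly B $ (s - n)\<bar>)" unfolding M_def by (rule sum_abs)
  also have "\<dots> \<le> (\<Sum>n\<in>{1..s}. c * 2 ^ K * X ^ (s - l))"
  proof (rule sum_mono)
    fix n assume n: "n \<in> {1..s}"
    show "\<bar>N n * recip_poly B $ (s - n)\<bar> \<le> c * 2 ^ K * X ^ (s - l)"
    proof (cases "n < l")
      case True
      then show ?thesis using N[OF n] X c0 by simp
    next
      case False
      have "\<bar>recip_poly B $ (s - n)\<bar> \<le> 2 ^ size B * X ^ (s - n)" using X B by (intro abs_recip_poly_nth_le) auto
      also have "\<dots> \<le> 2 ^ K * X ^ (s - n)"
        using X size by (intro mult_right_mono power_increasing) auto
      finally have "\<bar>N n * recip_poly B $ (s - n)\<bar> \<le> (c * X ^ (n - l)) * (2 ^ K * X ^ (s - n))"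
        unfolding abs_mult using N[OF n] X c0 by (intro mult_mono) auto
      also have "\<dots> = c * 2 ^ K * X ^ ((n - l) + (s - n))" by (simp add: power_add mult_ac)
      also have "(n - l) + (s - n) = s - l" using n False by auto
      finally show ?thesis .
    qed
  qed
  also have "\<dots> = real s * (c * 2 ^ K * X ^ (s - l))" by simp
  also have "\<dots> \<le> real K * (c * 2 ^ K * X ^ (s - l))"
    using size X c0 by (intro mult_right_mono) (auto simp: s_def)
  finally have "\<bar>of_int M'\<bar> \<le> cofactor_const K * X ^ (s - l)"
    by (simp add: M' cofactor_const_def c_def mult_ac)
  then show ?thesis using eq unfolding s_def by blast
qed

section \<open>Counting solutions up to permutation\<close>

lemma finite_card_multisets_of_size:
  assumes "finite D"
  shows "finite {A. size A = s \<and> set_mset A \<subseteq> D}"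
    and "card {A. size A = s \<and> set_mset A \<subseteq> D} \<le> card D ^ s"
proof -
  have eq: "{A. size A = s \<and> set_mset A \<subseteq> D} = mset ` {xs. set xs \<subseteq> D \<and> length xs = s}"
  proof (intro equalityI subsetI)
    fix A assume "A \<in> {A. size A = s \<and> set_mset A \<subseteq> D}"
    moreover obtain xs where "A = mset xs" by (metis ex_mset)
    ultimately show "A \<in> mset ` {xs. set xs \<subseteq> D \<and> length xs = s}" by auto
  qed auto
  have fin: "finite {xs. set xs \<subseteq> D \<and> length xs = s}" using assms by (rule finite_lists_length_eq)
  show "finite {A. size A = s \<and> set_mset A \<subseteq> D}" unfolding eq using fin by simp
  show "card {A. size A = s \<and> set_mset A \<subseteq> D} \<le> card D ^ s"
    unfolding eq using card_image_le[OF fin, of mset] card_lists_length_eq[OF assms, of s] by simp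
qed

definition box :: "real \<Rightarrow> int set" where
  "box X = {n. 1 \<le> n \<and> of_int n \<le> X}"

lemma box_eq: "box X = {1..\<lfloor>X\<rfloor>}"
  by (auto simp: box_def le_floor_iff)

lemma finite_box [simp]: "finite (box X)"
  by (simp add: box_eq)

lemma card_box_le: "X \<ge> 0 \<Longrightarrow> real (card (box X)) \<le> X"
  by (simp add: box_eq)

text \<open>
  The number \<open>s\<close> of pairs of variables is kept apart from the number \<open>K\<close> of equations: cancelling a
  value common to both sides lowers \<open>s\<close> but leaves all \<open>K\<close> equations in force.
\<close>
definition mset_sols :: "nat \<Rightarrow> nat \<Rightarrow> real \<Rightarrow> int \<Rightarrow> nat \<Rightarrow> (int multiset \<times> int multiset) set" where
  "mset_sols K l X h s = {(A, B). size A = s \<and> size B = s \<and> set_mset A \<subseteq> box X \<and> set_mset B \<subseteq> box X \<and>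
     (\<forall>j\<in>{1..K}. psum j A - psum j B = (if j = l then h else 0))}"

lemma finite_mset_sols: "finite (mset_sols K l X h s)"
proof (rule finite_subset)
  show "mset_sols K l X h s \<subseteq> {A. size A = s \<and> set_mset A \<subseteq> box X} \<times> {A. size A = s \<and> set_mset A \<subseteq> box X}"
    by (auto simp: mset_sols_def)
qed (simp add: finite_card_multisets_of_size)

lemma inj_on_fst_mset_sols:
  assumes "s \<le> K"
  shows "inj_on fst (mset_sols K l X h s)"
proof (rule inj_onI)
  fix p q assume p: "p \<in> mset_sols K l X h s" and q: "q \<in> mset_sols K l X h s" and "fst p = fst q"
  then obtain A B B' where pq: "p = (A, B)" "q = (A, B')" by (metis prod.collapse)
  have "psum j B = psum j B'" if "j \<in> {1..K}" for j
  proof -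
    have "psum j A - psum j B = psum j A - psum j B'"
      using p q that unfolding pq mset_sols_def by auto
    then show ?thesis by simp
  qed
  then have "B = B'"
    using p q assms unfolding pq mset_sols_def by (intro mset_eq_if_psum_eq) auto
  then show "p = q" by (simp add: pq)
qed

lemma mset_sols_empty:
  assumes "s < l" "l \<le> K" "h \<noteq> 0"
  shows "mset_sols K l X h s = {}"
proof (rule equals0I, clarify)
  fix A B assume AB: "(A, B) \<in> mset_sols K l X h s"
  have ps: "psum j A - psum j B = (if j = l then h else 0)" if "j \<in> {1..K}" for j
    using AB that by (simp add: mset_sols_def)
  have "psum j A = psum j B" if "j \<in> {1..s}" for j
    using ps[of j] that assms by simp
  then have "A = B" using AB by (intro mset_eq_if_psum_eq) (auto simp: mset_sols_def)
  then show False using ps[of l] assms by simp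
qed

text \<open>
  Every \<open>b - a\<close> divides \<open>n\<close>, up to sign, which leaves few choices for \<open>A\<close>; and \<open>A\<close> determines \<open>B\<close>.
\<close>
lemma card_mset_sols_with_product:
  assumes "n \<noteq> 0" "s \<le> K"
  shows "card {(A, B). (A, B) \<in> mset_sols K l X h s \<and> (\<Prod>a\<in>#A. b - a) = n}
           \<le> (2 * card {d. d dvd nat \<bar>n\<bar>}) ^ s" (is "card ?S \<le> _")
proof -
  define T where "T = {d. d dvd nat \<bar>n\<bar>}"
  have finT: "finite T" unfolding T_def using assms by (intro finite_divisors_nat) simp
  define D where "D = (\<lambda>d. b - int d) ` T \<union> (\<lambda>d. b + int d) ` T"
  have finD: "finite D" using finT by (simp add: D_def)
  have "card D \<le> card ((\<lambda>d. b - int d) ` T) + card ((\<lambda>d. b + int d) ` T)"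
    unfolding D_def by (rule card_Un_le)
  also have "\<dots> \<le> card T + card T" using finT by (intro add_mono card_image_le)
  finally have cardD: "card D \<le> 2 * card T" by simp
  have "fst ` ?S \<subseteq> {A. size A = s \<and> set_mset A \<subseteq> D}"
  proof (clarsimp)
    fix A B assume AB: "(A, B) \<in> mset_sols K l X h s" and n: "n = (\<Prod>a\<in>#A. b - a)"
    have "a \<in> D" if "a \<in># A" for a
    proof -
      have "b - a dvd n" unfolding n using that by (intro dvd_prod_mset) auto
      then have d: "nat \<bar>b - a\<bar> \<in> T" by (simp add: T_def nat_abs_dvd_iff nat_dvd_iff)
      show ?thesis
      proof (cases "a \<le> b")
        case True
        then have "a = b - int (nat \<bar>b - a\<bar>)" by simp
        then show ?thesis using d unfolding D_def by blast
      next
        case False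
        then have "a = b + int (nat \<bar>b - a\<bar>)" by simp
        then show ?thesis using d unfolding D_def by blast
      qed
    qed
    then show "size A = s \<and> set_mset A \<subseteq> D" using AB by (auto simp: mset_sols_def)
  qed
  then have "card (fst ` ?S) \<le> card {A. size A = s \<and> set_mset A \<subseteq> D}"
    by (intro card_mono finite_card_multisets_of_size finD)
  also have "\<dots> \<le> card D ^ s" by (intro finite_card_multisets_of_size finD)
  also have "\<dots> \<le> (2 * card T) ^ s" using cardD by (rule power_mono) simp
  also have "card (fst ` ?S) = card ?S"
    by (intro card_image inj_on_subset[OF inj_on_fst_mset_sols[OF assms(2), of l X h]]) auto
  finally show ?thesis by (simp add: T_def)
qed

text \<open>
  A large \<open>h\<close> admits no solutions; this is what makes the final bound uniform in \<open>h\<close>.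
\<close>
lemma abs_le_if_mset_sols:
  assumes "(A, B) \<in> mset_sols K l X h s" "l \<in> {1..K}" "s \<le> K" "X \<ge> 1"
  shows "\<bar>of_int h\<bar> \<le> real K * X ^ l"
proof -
  have le: "of_int (psum l M) \<le> real (size M) * X ^ l \<and> psum l M \<ge> 0" if "set_mset M \<subseteq> box X" for M
    using that
  proof (induction M)
    case empty
    show ?case by (simp add: psum_def)
  next
    case (add m M)
    have "of_int m \<le> X" "m \<ge> 0" using add.prems by (auto simp: box_def)
    then have "real_of_int (m ^ l) \<le> X ^ l" "m ^ l \<ge> 0" by (auto intro!: power_mono)
    then show ?case using add by (simp add: algebra_simps)
  qed
  have "h = psum l A - psum l B" using assms by (auto simp: mset_sols_def)
  then have "real_of_int h = of_int (psum l A) - of_int (psum l B)" by simp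
  moreover have "of_int (psum l A) \<le> real s * X ^ l" "of_int (psum l B) \<le> real s * X ^ l"
      "real_of_int (psum l A) \<ge> 0" "real_of_int (psum l B) \<ge> 0"
    using le[of A] le[of B] assms by (auto simp: mset_sols_def)
  moreover have "real s * X ^ l \<le> real K * X ^ l" using assms by (intro mult_right_mono) auto
  ultimately show ?thesis by linarith
qed

lemma abs_prod_diff_le:
  assumes "set_mset A \<subseteq> box X" "b \<in> box X"
  shows "\<bar>of_int (\<Prod>a\<in>#A. b - a)\<bar> \<le> X ^ size A"
  using assms(1)
proof (induction A)
  case (add a A)
  have "1 \<le> b" "1 \<le> a" "real_of_int a \<le> X" "real_of_int b \<le> X"
    using assms add.prems by (auto simp: box_def)
  then have "\<bar>real_of_int (b - a)\<bar> \<le> X" "X \<ge> 0" by auto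
  then have "\<bar>real_of_int (b - a)\<bar> * \<bar>of_int (\<Prod>a\<in>#A. b - a)\<bar> \<le> X * X ^ size A"
    using add by (intro mult_mono) auto
  then show ?case by (simp add: abs_mult)
qed simp

text \<open>
  Pick any element \<open>b\<close> of \<open>B\<close>. If it occurs in \<open>A\<close>, cancel it; otherwise the product of the
  differences \<open>b - a\<close> is non-zero, and it is one of the few values permitted by \<open>prod_diff_cofactor\<close>.
\<close>
lemma mset_sols_Suc_cover:
  fixes h :: int and X :: real
  assumes l: "1 \<le> l" "l \<le> Suc t" and t: "Suc t \<le> K" and X: "X \<ge> 1"
  defines "Q \<equiv> {n. n \<noteq> 0 \<and> \<bar>real_of_int n\<bar> \<le> X ^ K \<and>
      (\<exists>M::int. int (l ^ K * fact K) * n = h * M \<and> \<bar>of_int M\<bar> \<le> cofactor_const K * X ^ (Suc t - l))}"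
  shows "mset_sols K l X h (Suc t)
    \<subseteq> (\<lambda>(b, A, B). (add_mset b A, add_mset b B)) ` (box X \<times> mset_sols K l X h t)
       \<union> (\<Union>(b, n) \<in> box X \<times> Q. {(A, B). (A, B) \<in> mset_sols K l X h (Suc t) \<and> (\<Prod>a\<in>#A. b - a) = n})"
    (is "_ \<subseteq> ?U1 \<union> ?U2")
proof clarify
  fix A B assume AB: "(A, B) \<in> mset_sols K l X h (Suc t)" and n2: "(A, B) \<notin> ?U2"
  then have "size B = Suc t" by (simp add: mset_sols_def)
  then obtain b B' where B: "B = add_mset b B'" by (metis size_eq_Suc_imp_eq_union)
  have b: "b \<in> box X" and B'X: "set_mset B' \<subseteq> box X" and AX: "set_mset A \<subseteq> box X"
    and sz: "size A = Suc t" "size B' = t"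
    and ps: "\<forall>j\<in>{1..K}. psum j A - psum j (add_mset b B') = (if j = l then h else 0)"
    using AB by (auto simp: mset_sols_def B)
  show "(A, B) \<in> ?U1"
  proof (cases "b \<in># A")
    case True
    then obtain A' where A: "A = add_mset b A'" by (metis insert_DiffM)
    have "(A', B') \<in> mset_sols K l X h t"
      using AB unfolding mset_sols_def A B by auto
    then show ?thesis using b unfolding A B by (force intro!: image_eqI[where x = "(b, A', B')"])
  next
    case False
    define n where "n = (\<Prod>a\<in>#A. b - a)"
    have n0: "n \<noteq> 0" using False by (auto simp: n_def prod_mset_zero_iff)
    have "\<bar>real_of_int n\<bar> \<le> X ^ Suc t" using abs_prod_diff_le[OF AX b] sz by (simp add: n_def)
    also have "\<dots> \<le> X ^ K" using t X by (intro power_increasing)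
    finally have nX: "\<bar>real_of_int n\<bar> \<le> X ^ K" .
    have "\<exists>M::int. int (l ^ K * fact K) * (\<Prod>a\<in>#A. b - a) = h * M \<and>
           \<bar>of_int M\<bar> \<le> cofactor_const K * X ^ (size A - l)"
    proof (rule prod_diff_cofactor[OF _ _ ps])
      show "\<bar>of_int h\<bar> \<le> real K * X ^ l" using AB l t X by (intro abs_le_if_mset_sols) auto
      show "\<forall>a\<in>#B'. \<bar>of_int a\<bar> \<le> X" using B'X by (auto simp: box_def)
    qed (use l t X sz in auto)
    then have "n \<in> Q" using n0 nX sz by (simp add: Q_def n_def)
    then have "(A, B) \<in> ?U2" using b AB by (auto simp: n_def)
    then show ?thesis using n2 by contradiction
  qed
qed

text \<open>
  Each \<open>n\<close> is determined by its cofactor \<open>M\<close>, so the count does not depend on \<open>D\<close> and \<open>h\<close>.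
\<close>
lemma card_cofactors:
  assumes D: "D \<noteq> (0::int)" and Y: "Y \<ge> 0"
  shows "finite {n::int. P n \<and> (\<exists>M. D * n = h * M \<and> \<bar>real_of_int M\<bar> \<le> Y)}" (is "finite ?Q")
    and "real (card {n::int. P n \<and> (\<exists>M. D * n = h * M \<and> \<bar>real_of_int M\<bar> \<le> Y)}) \<le> 2 * Y + 1"
proof -
  have sub: "?Q \<subseteq> (\<lambda>M. h * M div D) ` {-\<lfloor>Y\<rfloor>..\<lfloor>Y\<rfloor>}"
  proof clarify
    fix n M assume n: "D * n = h * M" and M: "\<bar>real_of_int M\<bar> \<le> Y"
    have "n = h * M div D" using n D by (metis nonzero_mult_div_cancel_left)
    moreover have "M \<in> {-\<lfloor>Y\<rfloor>..\<lfloor>Y\<rfloor>}" using M by (auto simp: le_floor_iff) linarith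
    ultimately show "n \<in> (\<lambda>M. h * M div D) ` {-\<lfloor>Y\<rfloor>..\<lfloor>Y\<rfloor>}" by blast
  qed
  then show "finite ?Q" by (rule finite_subset) simp
  have "card ?Q \<le> card ((\<lambda>M. h * M div D) ` {-\<lfloor>Y\<rfloor>..\<lfloor>Y\<rfloor>})" using sub by (intro card_mono) auto
  also have "\<dots> \<le> card {-\<lfloor>Y\<rfloor>..\<lfloor>Y\<rfloor>}" by (intro card_image_le) simp
  also have "\<dots> = nat (2 * \<lfloor>Y\<rfloor> + 1)" by simp
  finally have "real (card ?Q) \<le> real (nat (2 * \<lfloor>Y\<rfloor> + 1))" by (simp only: of_nat_le_iff)
  also have "\<dots> \<le> 2 * Y + 1" using Y by (simp add: of_nat_nat)
  finally show "real (card ?Q) \<le> 2 * Y + 1" .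
qed

text \<open>
  The first summand counts the solutions with a value common to both sides. For the others there
  are \<open>X\<close> choices of \<open>b\<close>, of the order of \<open>X ^ (Suc t - l)\<close> choices of the product, and \<open>V\<close> choices
  of \<open>(A, B)\<close> once these are known.
\<close>
lemma card_mset_sols_Suc_le:
  assumes l: "1 \<le> l" "l \<le> Suc t" and t: "Suc t \<le> K" and X: "X \<ge> 1" and V: "V \<ge> 1"
    and dv: "\<And>n::int. n \<noteq> 0 \<Longrightarrow> \<bar>real_of_int n\<bar> \<le> X ^ K \<Longrightarrow> real (2 * card {d. d dvd nat \<bar>n\<bar>}) ^ K \<le> V"
  shows "real (card (mset_sols K l X h (Suc t)))
     \<le> X * real (card (mset_sols K l X h t)) + (2 * cofactor_const K + 1) * X ^ (Suc (Suc t) - l) * V"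
proof -
  define Y where "Y = cofactor_const K * X ^ (Suc t - l)"
  define Q where "Q = {n. (n \<noteq> 0 \<and> \<bar>real_of_int n\<bar> \<le> X ^ K) \<and>
      (\<exists>M::int. int (l ^ K * fact K) * n = h * M \<and> \<bar>of_int M\<bar> \<le> Y)}"
  define F where "F = (\<lambda>(b, n). {(A, B). (A, B) \<in> mset_sols K l X h (Suc t) \<and> (\<Prod>a\<in>#A. b - a) = n})"
  have cc: "cofactor_const K \<ge> 0" by (simp add: cofactor_const_def)
  then have Y0: "Y \<ge> 0" using X by (simp add: Y_def)
  have D0: "int (l ^ K * fact K) \<noteq> 0" using l by simp
  have finQ: "finite Q" and cardQ: "real (card Q) \<le> 2 * Y + 1"
    unfolding Q_def by (rule card_cofactors[OF D0 Y0])+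
  have cardF: "real (card (F p)) \<le> V" if "p \<in> box X \<times> Q" for p
  proof -
    obtain b n where p: "p = (b, n)" "n \<noteq> 0" "\<bar>real_of_int n\<bar> \<le> X ^ K"
      using \<open>p \<in> box X \<times> Q\<close> by (auto simp: Q_def)
    let ?d = "2 * card {d. d dvd nat \<bar>n\<bar>}"
    have "finite {d. d dvd nat \<bar>n\<bar>}" using p by (intro finite_divisors_nat) simp
    moreover have "1 \<in> {d. d dvd nat \<bar>n\<bar>}" by simp
    ultimately have "card {d. d dvd nat \<bar>n\<bar>} > 0" by (metis card_gt_0_iff empty_iff)
    then have d1: "?d \<ge> 1" by simp
    have "card (F p) \<le> ?d ^ Suc t"
      unfolding F_def p using card_mset_sols_with_product[OF p(2) t] by simp
    also have "\<dots> \<le> ?d ^ K" using d1 t by (intro power_increasing)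
    finally have "real (card (F p)) \<le> real (?d ^ K)" by (simp only: of_nat_le_iff)
    also have "\<dots> \<le> V" using dv[OF p(2,3)] by simp
    finally show ?thesis .
  qed
  have finF: "finite (F p)" for p
    by (rule finite_subset[OF _ finite_mset_sols[of K l X h "Suc t"]]) (auto simp: F_def split: prod.splits)
  let ?f = "\<lambda>(b, A, B). (add_mset b A, add_mset b B)"
  have "card (mset_sols K l X h (Suc t))
      \<le> card (?f ` (box X \<times> mset_sols K l X h t) \<union> (\<Union>p\<in>box X \<times> Q. F p))"
  proof (rule card_mono)
    show "finite (?f ` (box X \<times> mset_sols K l X h t) \<union> (\<Union>p\<in>box X \<times> Q. F p))"
      using finQ finF by (simp add: finite_mset_sols)
    show "mset_sols K l X h (Suc t) \<subseteq> ?f ` (box X \<times> mset_sols K l X h t) \<union> (\<Union>p\<in>box X \<times> Q. F p)"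
      using mset_sols_Suc_cover[OF l t X, of h] unfolding F_def Q_def Y_def
      by (simp only: conj_assoc)
  qed
  also have "\<dots> \<le> card (?f ` (box X \<times> mset_sols K l X h t)) + card (\<Union>p\<in>box X \<times> Q. F p)"
    by (rule card_Un_le)
  also have "card (?f ` (box X \<times> mset_sols K l X h t)) \<le> card (box X \<times> mset_sols K l X h t)"
    by (intro card_image_le) (simp add: finite_mset_sols)
  also have "card (\<Union>p\<in>box X \<times> Q. F p) \<le> (\<Sum>p\<in>box X \<times> Q. card (F p))"
    using finQ by (intro card_UN_le) simp
  finally have "card (mset_sols K l X h (Suc t))
      \<le> card (box X) * card (mset_sols K l X h t) + (\<Sum>p\<in>box X \<times> Q. card (F p))"
    by (simp add: card_cartesian_product)
  then have "real (card (mset_sols K l X h (Suc t)))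
      \<le> real (card (box X) * card (mset_sols K l X h t) + (\<Sum>p\<in>box X \<times> Q. card (F p)))"
    by (simp only: of_nat_le_iff)
  also have "\<dots> = real (card (box X)) * real (card (mset_sols K l X h t)) + (\<Sum>p\<in>box X \<times> Q. real (card (F p)))"
    by simp
  also have "\<dots> \<le> X * real (card (mset_sols K l X h t)) + (\<Sum>p\<in>box X \<times> Q. V)"
    using X card_box_le[of X] cardF by (intro add_mono mult_right_mono sum_mono) auto
  also have "(\<Sum>p\<in>box X \<times> Q. V) = real (card (box X)) * real (card Q) * V"
    by (simp add: card_cartesian_product)
  also have "\<dots> \<le> X * ((2 * cofactor_const K + 1) * X ^ (Suc t - l)) * V"
  proof -
    have "1 \<le> X ^ (Suc t - l)" using X by simp
    then have "real (card Q) \<le> (2 * cofactor_const K + 1) * X ^ (Suc t - l)"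
      using cardQ unfolding Y_def by (simp add: algebra_simps)
    then show ?thesis using X V cc card_box_le[of X] by (intro mult_mono mult_nonneg_nonneg) auto
  qed
  also have "X * ((2 * cofactor_const K + 1) * X ^ (Suc t - l)) * V
      = (2 * cofactor_const K + 1) * X ^ (Suc (Suc t) - l) * V"
    using l by (simp add: Suc_diff_le)
  finally show ?thesis by simp
qed

text \<open>
  Both summands of the recursion have order \<open>X ^ (Suc s - l) * V\<close>, as cancelling a common value
  costs a factor \<open>X\<close> but lowers \<open>s\<close> by one. The induction starts below \<open>s = l\<close>, where there are no
  solutions.
\<close>
lemma card_mset_sols_le:
  assumes l: "1 \<le> l" "l \<le> K" and h: "h \<noteq> 0" and s: "s \<le> K" and X: "X \<ge> 1" and V: "V \<ge> 1"
    and dv: "\<And>n::int. n \<noteq> 0 \<Longrightarrow> \<bar>real_of_int n\<bar> \<le> X ^ K \<Longrightarrow> real (2 * card {d. d dvd nat \<bar>n\<bar>}) ^ K \<le> V"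
  shows "real (card (mset_sols K l X h s)) \<le> real s * (2 * cofactor_const K + 1) * X ^ (Suc s - l) * V"
  using s
proof (induction s)
  case 0
  then show ?case using l h mset_sols_empty[of 0 l K h X] by simp
next
  case (Suc t)
  define c where "c = 2 * cofactor_const K + 1"
  show ?case
  proof (cases "Suc t < l")
    case True
    have "c \<ge> 0" by (simp add: c_def cofactor_const_def)
    then show ?thesis using mset_sols_empty[OF True l(2) h, of X] X V by (simp flip: c_def)
  next
    case False
    then have "X ^ (Suc (Suc t) - l) = X * X ^ (Suc t - l)" by (simp add: Suc_diff_le not_less)
    moreover have "X * real (card (mset_sols K l X h t)) \<le> X * (real t * c * X ^ (Suc t - l) * V)"
      using Suc X by (intro mult_left_mono) (auto simp: c_def)
    moreover have "real (card (mset_sols K l X h (Suc t)))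
        \<le> X * real (card (mset_sols K l X h t)) + c * X ^ (Suc (Suc t) - l) * V"
      unfolding c_def using False Suc.prems l by (intro card_mset_sols_Suc_le X V dv) auto
    ultimately show ?thesis unfolding c_def[symmetric] by (simp add: algebra_simps)
  qed
qed

section \<open>The inhomogeneous Vinogradov system\<close>

text \<open>
  Passing to multisets loses only a bounded factor: a \<open>k\<close>-tuple with given value multiset is a
  function into a set of at most \<open>k\<close> values.
\<close>
lemma card_Jsol_le:
  assumes k: "1 \<le> k" and h: "\<forall>j\<in>{1..k}. j \<noteq> l \<longrightarrow> h j = 0"
  shows "J k k X h \<le> k ^ k * k ^ k * card (mset_sols k l X (h l) k)"
proof -
  let ?m = "\<lambda>x. image_mset x (mset_set {1..k})"
  define F where "F = (\<lambda>(A, B). ({1..k} \<rightarrow>\<^sub>E set_mset (A :: int multiset)) \<times> ({1..k} \<rightarrow>\<^sub>E set_mset (B :: int multiset)))"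
  have sub: "Jsol k k X h \<subseteq> (\<Union>p\<in>mset_sols k l X (h l) k. F p)"
  proof
    fix p assume "p \<in> Jsol k k X h"
    then obtain x y where p: "p = (x, y)" and x: "x \<in> {1..k} \<rightarrow>\<^sub>E box X" and y: "y \<in> {1..k} \<rightarrow>\<^sub>E box X"
      and eq: "\<forall>j\<in>{1..k}. (\<Sum>i=1..k. x i ^ j - y i ^ j) = h j"
      by (auto simp: Jsol_def box_def)
    have ps: "psum j (?m z) = (\<Sum>i=1..k. z i ^ j)" for j z
      by (simp add: psum_def sum_unfold_sum_mset image_mset.compositionality comp_def)
    have "psum j (?m x) - psum j (?m y) = (if j = l then h l else 0)" if "j \<in> {1..k}" for j
      using eq h that unfolding ps by (auto simp: sum_subtractf)
    then have "(?m x, ?m y) \<in> mset_sols k l X (h l) k"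
      using x y by (auto simp: mset_sols_def)
    moreover have "p \<in> F (?m x, ?m y)"
      using x y unfolding p F_def by (auto simp: PiE_def)
    ultimately show "p \<in> (\<Union>p\<in>mset_sols k l X (h l) k. F p)" by blast
  qed
  have cardF: "finite (F p) \<and> card (F p) \<le> k ^ k * k ^ k" if pin: "p \<in> mset_sols k l X (h l) k" for p
  proof -
    obtain A B where p: "p = (A, B)" by force
    have "size A = k" "size B = k" using pin by (auto simp: p mset_sols_def)
    then have "card (set_mset A) \<le> k" "card (set_mset B) \<le> k"
      by (metis card_length ex_mset set_mset_mset size_mset)+
    then show ?thesis
      unfolding p F_def by (auto simp: card_cartesian_product card_funcsetE intro!: mult_mono power_mono finite_PiE)
  qed
  have "card (Jsol k k X h) \<le> card (\<Union>p\<in>mset_sols k l X (h l) k. F p)"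
    using cardF by (intro card_mono[OF _ sub] finite_UN_I finite_mset_sols) auto
  also have "\<dots> \<le> (\<Sum>p\<in>mset_sols k l X (h l) k. card (F p))"
    by (intro card_UN_le finite_mset_sols)
  also have "\<dots> \<le> (\<Sum>p\<in>mset_sols k l X (h l) k. k ^ k * k ^ k)"
    using cardF by (intro sum_mono) auto
  finally show ?thesis by (simp add: J_def mult_ac)
qed

theorem theorem1p5:
  fixes k :: nat and \<epsilon> :: real
  assumes "k \<ge> 3" and "\<epsilon> > 0"
  shows "\<exists>C>0. \<exists>X0>0. \<forall>X\<ge>X0. \<forall>(h :: nat \<Rightarrow> int) (l :: nat).
           (\<exists>j\<in>{1..k}. h j \<noteq> 0) \<longrightarrow>
           2 \<le> l \<longrightarrow> l \<le> k \<longrightarrow> h l \<noteq> 0 \<longrightarrow> (\<forall>j\<in>{1..k}. j \<noteq> l \<longrightarrow> h j = 0) \<longrightarrow>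
           real (J k k X h) \<le> C * X powr (real k - real l + 1 + \<epsilon>)"
proof -
  \<comment> \<open>The divisor bound is applied to integers up to \<open>X ^ k\<close>, and its result is raised to the power \<open>k\<close>.\<close>
  define \<delta> where "\<delta> = \<epsilon> / (real k * real k)"
  have k0: "real k > 0" using assms by simp
  have "\<delta> > 0" using assms k0 by (simp add: \<delta>_def)
  then obtain c where c: "c \<ge> 1" "\<And>n::nat. n > 0 \<Longrightarrow> real (card {d. d dvd n}) \<le> c * real n powr \<delta>"
    using divisor_bound by blast
  define C where "C = real (k ^ k * k ^ k) * (real k * (2 * cofactor_const k + 1)) * (2 * c) ^ k"
  have cc: "2 * cofactor_const k + 1 > 0" by (simp add: cofactor_const_def add_nonneg_pos)
  have C0: "C > 0" unfolding C_def using cc c(1) k0 by (intro mult_pos_pos zero_less_power) auto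
  have main: "real (J k k X h) \<le> C * X powr (real k - real l + 1 + \<epsilon>)"
    if X: "X \<ge> 1" and l: "2 \<le> l" "l \<le> k" and hl: "h l \<noteq> 0" and h: "\<forall>j\<in>{1..k}. j \<noteq> l \<longrightarrow> h j = 0"
    for X h l
  proof -
    define V where "V = (2 * c) ^ k * X powr \<epsilon>"
    have "1 \<le> (2 * c) ^ k" using c(1) by (intro one_le_power) simp
    moreover have "1 \<le> X powr \<epsilon>" using X assms by (simp add: ge_one_powr_ge_zero)
    ultimately have V1: "V \<ge> 1" unfolding V_def by (metis mult_mono' mult_1 zero_le_one)
    have dv: "real (2 * card {d. d dvd nat \<bar>n\<bar>}) ^ k \<le> V"
      if n: "n \<noteq> 0" "\<bar>real_of_int n\<bar> \<le> X ^ k" for n :: int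
    proof -
      have rn: "real (nat \<bar>n\<bar>) = \<bar>real_of_int n\<bar>" by simp
      have "real (card {d. d dvd nat \<bar>n\<bar>}) \<le> c * real (nat \<bar>n\<bar>) powr \<delta>" using n by (intro c(2)) simp
      also have "\<dots> \<le> c * (X ^ k) powr \<delta>"
        using n c(1) \<open>\<delta> > 0\<close> unfolding rn by (intro mult_left_mono powr_mono2) auto
      also have "(X ^ k) powr \<delta> = X powr (real k * \<delta>)"
        using X by (simp add: powr_powr flip: powr_realpow)
      finally have "real (2 * card {d. d dvd nat \<bar>n\<bar>}) \<le> 2 * c * X powr (real k * \<delta>)" by simp
      then have "real (2 * card {d. d dvd nat \<bar>n\<bar>}) ^ k \<le> (2 * c * X powr (real k * \<delta>)) ^ k"
        by (intro power_mono) auto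
      also have "\<dots> = (2 * c) ^ k * X powr (real k * (real k * \<delta>))"
        using X by (simp add: power_mult_distrib powr_power mult.commute)
      also have "real k * (real k * \<delta>) = \<epsilon>" using k0 by (simp add: \<delta>_def)
      finally show ?thesis by (simp add: V_def)
    qed
    have "real (J k k X h) \<le> real (k ^ k * k ^ k * card (mset_sols k l X (h l) k))"
      using card_Jsol_le[OF _ h] assms by (simp only: of_nat_le_iff)
    also have "\<dots> = real (k ^ k * k ^ k) * real (card (mset_sols k l X (h l) k))" by simp
    also have "\<dots> \<le> real (k ^ k * k ^ k) * (real k * (2 * cofactor_const k + 1) * X ^ (Suc k - l) * V)"
      using l by (intro mult_left_mono card_mset_sols_le hl X V1 dv) auto
    also have "\<dots> = C * (X ^ (Suc k - l) * X powr \<epsilon>)" by (simp add: C_def V_def mult_ac)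
    also have "X ^ (Suc k - l) = X powr (real k - real l + 1)"
      using X l by (simp add: of_nat_diff algebra_simps flip: powr_realpow)
    also have "X powr (real k - real l + 1) * X powr \<epsilon> = X powr (real k - real l + 1 + \<epsilon>)"
      by (rule powr_add[symmetric])
    finally show ?thesis .
  qed
  show ?thesis
    using C0 main by (intro exI[of _ C] conjI exI[of _ "1::real"]) auto
qed

end
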